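(* Let $d>0$, let $r_{\mathrm R}(x)=\bigl(1-\frac xd\bigr)\mathbf{1}[0\le x\le d]$ for $x\ge0$, and let $r_{\mathrm L}$ on $(-\infty,0]$ be arbitrary as in the context. Let $\gamma\in\mathbb{R}$, $\gamma\ne0$. Then the unique solution $\eta^{\mathrm{opt}}\ge0$ of the threshold equation $r(\eta)=R_{\mathrm T}(\eta)$ is $$\eta^{\mathrm{opt}}=r_0+\frac1\gamma W\Bigl(\frac{\gamma e^{-\gamma r_0}}{a_0}\Bigr),$$ where $W$ denotes Lambert's W function and $$a_0=-\gamma^2\Bigl(B+\frac1\gamma\Bigr),\qquad r_0=\frac{d(B-A)+\frac1{\gamma^2}}{B+\frac1\gamma}.$$
   Context: $\phi,\Phi$ are the standard normal density and distribution function. $r:\mathbb{R}\to[0,1]$ equals $r_{\mathrm L}$ on $(-\infty,0]$ and $r_{\mathrm R}$ on $[0,\infty)$, where $r_{\mathrm L}:(-\infty,0]\to[0,1]$ is continuous, piecewise smooth, nondecreasing, with $r_{\mathrm L}(0)=1$ and $r_{\mathrm L}$ not identically $1$. Set $$A=\int_{-\infty}^0 r_{\mathrm L}(x)e^{-\frac12x^2-\gamma x}\,dx,\qquad B=\frac{\Phi(\gamma)}{\phi(\gamma)},\qquad R_{\mathrm T}(\eta)=\frac{A+\int_0^\eta r(x)e^{-\gamma x}\,dx}{B+\int_0^\eta e^{-\gamma x}\,dx}\quad(\eta\ge0).$$ Lambert's W function: $W(z)$ denotes a real number $w$ with $we^w=z$; of the two real branches, the one is taken for which the resulting value of $\eta^{\mathrm{opt}}$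 is positive. *)

theory Defs
  imports "HOL-Probability.Probability"
begin

definition Phi :: "real \<Rightarrow> real"
  where "Phi = cdf std_normal_distribution"

definition A_const :: "real \<Rightarrow> (real \<Rightarrow> real) \<Rightarrow> real"
  where "A_const \<gamma> rL = (LBINT x:{..0}. rL x * exp (- x\<^sup>2 / 2 - \<gamma> * x))"

definition B_const :: "real \<Rightarrow> real"
  where "B_const \<gamma> = Phi \<gamma> / std_normal_density \<gamma>"

text \<open>Functions given on a half line are represented by total functions whose values
  on the other half line are ignored.\<close>

definition glue :: "(real \<Rightarrow> real) \<Rightarrow> (real \<Rightarrow> real) \<Rightarrow> real \<Rightarrow> real"
  where "glue rL rR x = (if x \<le> 0 then rL x else rR x)"

text \<open>Meaningful for \<open>\<eta> \<ge> 0\<close> only.\<close>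

definition R_T :: "real \<Rightarrow> (real \<Rightarrow> real) \<Rightarrow> (real \<Rightarrow> real) \<Rightarrow> real \<Rightarrow> real"
  where "R_T \<gamma> rL rR \<eta> =
    (A_const \<gamma> rL + (LBINT x:{0..\<eta>}. glue rL rR x * exp (- \<gamma> * x))) /
    (B_const \<gamma> + (LBINT x:{0..\<eta>}. exp (- \<gamma> * x)))"

text \<open>The admissible left parts. Piecewise smooth means piecewise continuously
  differentiable; the breakpoints may accumulate only at \<open>-\<infinity>\<close>, which is why the
  library notion, with its finite exceptional set, is imposed on compact intervals.\<close>

definition admissible_left :: "(real \<Rightarrow> real) \<Rightarrow> bool"
  where "admissible_left rL \<longleftrightarrow>
    rL ` {..0} \<subseteq> {0..1} \<and>
    continuous_on {..0} rL \<and>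
    (\<forall>a<0. rL piecewise_C1_differentiable_on {a..0}) \<and>
    mono_on {..0} rL \<and>
    rL 0 = 1 \<and>
    (\<exists>x\<le>0. rL x \<noteq> 1)"

text \<open>The two real branches of the inverse of \<open>w \<mapsto> w * exp w\<close>. The first is meaningful
  for \<open>z \<ge> - exp (-1)\<close>, the second for \<open>- exp (-1) \<le> z < 0\<close>.\<close>

definition lambert_W0 :: "real \<Rightarrow> real"
  where "lambert_W0 z = (THE w. w \<ge> -1 \<and> w * exp w = z)"

definition lambert_Wm1 :: "real \<Rightarrow> real"
  where "lambert_Wm1 z = (THE w. w \<le> -1 \<and> w * exp w = z)"

end

theory Submission
  imports Defs "HOL-Real_Asymp.Real_Asymp"
begin

text \<open>Multiplying the threshold equation on \<open>{0..d}\<close> by the positive denominator of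
  \<^const>\<open>R_T\<close> turns it into \<open>G \<eta> = 0\<close> for an elementary function \<open>G\<close>
  (\<open>threshold_gap\<close>) with derivative
  \[ G'(\eta) = -\frac1d \Bigl(B + \int_0^\eta e^{-\gamma x}\,dx\Bigr). \]
  The derivative is negative for \<open>\<eta> \<ge> 0\<close>. Moreover \<open>G 0 = B - A\<close> is positive, because the left part
  lies strictly below \<open>1\<close> somewhere, and \<open>G d\<close> is negative, because \<open>A > 0\<close>. Hence \<open>G\<close> has
  exactly one zero \<open>\<eta>\<close> on the nonnegative half-line. Beyond \<open>d\<close> there is no solution, since
  \<open>r\<close> vanishes there, whereas \<^const>\<open>R_T\<close> stays positive.

  Being a linear function plus an exponential, \<open>G\<close> has a zero at \<open>t\<close> if and only if
  \<open>w = \<gamma> * (t - r\<^sub>0)\<close> solves \<open>w * exp w = z\<close>. This step divides by \<open>B + 1 / \<gamma>\<close>, which has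
  the sign of \<open>\<gamma>\<close> by the Mills ratio bound \<open>\<gamma> * B + 1 > 0\<close>; so also \<open>z < 0\<close>, and the zero
  \<open>\<eta>\<close> itself witnesses \<open>- exp (-1) \<le> z\<close>. Thus both real branches of Lambert's function are
  defined at \<open>z\<close>, and each of them yields a zero of \<open>G\<close> on the whole real line. The branch point \<open>w = -1\<close>
  corresponds to a critical point of \<open>G\<close>, which \<open>\<eta>\<close> is not. So the two branches differ at \<open>z\<close>,
  one of them yields \<open>\<eta>\<close>, and the other one yields another zero, which must be negative.\<close>

section \<open>Integrals over the negative half-line\<close>

text \<open>The points where the continuous functions differ strictly form a nonempty open set, which
  is not a null set. The point \<open>x0\<close> is interior to the half-line, so that no one-sided
  neighbourhood is needed.\<close>

lemma set_integral_nonpos_strict_mono: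
  fixes f g :: "real \<Rightarrow> real"
  assumes f: "set_integrable lborel {..0} f" and g: "set_integrable lborel {..0} g"
    and cont: "continuous_on {..0} f" "continuous_on {..0} g"
    and le: "\<And>x. x \<le> 0 \<Longrightarrow> f x \<le> g x"
    and less: "x0 < 0" "f x0 < g x0"
  shows "(LBINT x:{..0}. f x) < (LBINT x:{..0}. g x)"
proof -
  define h where "h x = indicator {..0} x *\<^sub>R (g x - f x)" for x :: real
  have h_int: "integrable lborel h"
    using set_integral_diff(1)[OF g f] unfolding h_def set_integrable_def by simp
  have h_nonneg: "h x \<ge> 0" for x
    using le by (auto simp: h_def indicator_def)
  have diff: "(LBINT x:{..0}. g x) - (LBINT x:{..0}. f x) = integral\<^sup>L lborel h"
    using set_integral_diff(2)[OF g f] unfolding h_def set_lebesgue_integral_def by simp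
  have "integral\<^sup>L lborel h \<noteq> 0"
  proof
    assume "integral\<^sup>L lborel h = 0"
    hence ae: "AE x in lborel. h x = 0"
      using integral_nonneg_eq_0_iff_AE[OF h_int] h_nonneg by simp
    define S where "S = {x \<in> {..<0}. 0 < g x - f x}"
    have "continuous_on {..<0} (\<lambda>x. g x - f x)"
      by (intro continuous_intros continuous_on_subset[OF cont(1)] continuous_on_subset[OF cont(2)])
         auto
    hence "open ({..<0} \<inter> (\<lambda>x. g x - f x) -` {0<..})"
      by (intro continuous_open_preimage) auto
    also have "{..<0} \<inter> (\<lambda>x. g x - f x) -` {0<..} = S"
      by (auto simp: S_def)
    finally have "open S" .
    moreover have "S \<in> null_sets lborel"
    proof -
      have "AE x in lborel. x \<notin> S"
        using ae by eventually_elim (auto simp: S_def h_def)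
      thus ?thesis
        using \<open>open S\<close> by (subst AE_iff_null_sets) auto
    qed
    hence "negligible S"
      by (simp add: negligible_iff_null_sets null_sets_completionI)
    moreover have "x0 \<in> S"
      using less by (auto simp: S_def)
    ultimately show False
      using open_not_negligible by blast
  qed
  moreover have "integral\<^sup>L lborel h \<ge> 0"
    using h_nonneg by (intro integral_nonneg_AE) auto
  ultimately show ?thesis
    using diff by linarith
qed

lemma has_bochner_integral_exp_nonpos:
  fixes c :: real
  assumes "c > 0"
  shows "has_bochner_integral lborel (\<lambda>x. indicator {..0} x *\<^sub>R exp (c * x)) (1 / c)"
proof -
  have lim: "((\<lambda>x. - exp (- (c * x)) / c) \<longlongrightarrow> 0) at_top"
    using assms by real_asymp
  have "(\<integral>\<^sup>+x. ennreal (exp (- (c * x))) * indicator {0..} x \<partial>lborel) = ennreal (0 - (- exp (- (c * 0)) / c))"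
    by (rule nn_integral_FTC_atLeast[OF _ _ _ lim])
       (use assms in \<open>auto intro!: derivative_eq_intros\<close>)
  also have "(\<integral>\<^sup>+x. ennreal (exp (- (c * x))) * indicator {0..} x \<partial>lborel)
      = (\<integral>\<^sup>+x. ennreal (indicator {0..} x *\<^sub>R exp (- (c * x))) \<partial>lborel)"
    by (intro nn_integral_cong) (auto simp: indicator_def)
  finally have "has_bochner_integral lborel (\<lambda>x. indicator {0..} x *\<^sub>R exp (- (c * x))) (1 / c)"
    using assms by (intro has_bochner_integral_nn_integral) auto
  from lborel_has_bochner_integral_real_affine_iff[THEN iffD1, OF _ this, of "-1" 0]
  have "has_bochner_integral lborel (\<lambda>x. indicator {0..} (- x) *\<^sub>R exp (c * x)) (1 / c)"
    by simp
  moreover have "indicator {0..} (- x) = (indicator {..0} x :: real)" for x :: real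
    by (auto simp: indicator_def)
  ultimately show ?thesis by simp
qed

section \<open>The constants A and B, and the Mills ratio\<close>

text \<open>Completing the square: the weight in \<^const>\<open>A_const\<close> is a translated normal density.\<close>

lemma gauss_tilt_eq:
  "exp (- x\<^sup>2 / 2 - \<gamma> * x) = std_normal_density (\<gamma> + x) / std_normal_density (\<gamma> :: real)"
proof -
  have "exp (- x\<^sup>2 / 2 - \<gamma> * x) * exp (- \<gamma>\<^sup>2 / 2) = exp (- (\<gamma> + x)\<^sup>2 / 2)"
    by (simp add: power2_eq_square field_simps flip: exp_add)
  thus ?thesis
    by (simp add: std_normal_density_def field_simps)
qed

lemma gauss_tilt_integrable:
  "set_integrable lborel {..0} (\<lambda>x :: real. exp (- x\<^sup>2 / 2 - \<gamma> * x))"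
proof -
  have "integrable lborel (\<lambda>x. std_normal_density (\<gamma> + 1 * x))"
    by (intro lborel_integrable_real_affine) auto
  hence "integrable lborel (\<lambda>x :: real. exp (- x\<^sup>2 / 2 - \<gamma> * x))"
    unfolding gauss_tilt_eq by simp
  thus ?thesis
    unfolding set_integrable_def by (intro integrable_mult_indicator) auto
qed

text \<open>Thus \<^const>\<open>B_const\<close> is what \<^const>\<open>A_const\<close> becomes for the constant left part \<open>1\<close>,
  which makes the two constants comparable.\<close>

lemma B_const_eq_integral:
  "B_const \<gamma> = (LBINT x:{..0}. exp (- x\<^sup>2 / 2 - \<gamma> * x))"
proof -
  have "Phi \<gamma> = (\<integral>x. indicator {..\<gamma>} x \<partial>density lborel std_normal_density)"
    by (simp add: Phi_def cdf_def)
  also have "\<dots> = (\<integral>x. std_normal_density x * indicator {..\<gamma>} x \<partial>lborel)"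
    by (subst integral_density) auto
  also have "\<dots> = (\<integral>x. std_normal_density (\<gamma> + x) * indicator {..\<gamma>} (\<gamma> + x) \<partial>lborel)"
    by (subst lborel_integral_real_affine[where c = 1 and t = \<gamma>]) auto
  also have "\<dots> = (\<integral>x. indicator {..0} x *\<^sub>R std_normal_density (\<gamma> + x) \<partial>lborel)"
    by (intro Bochner_Integration.integral_cong) (auto simp: indicator_def)
  finally show ?thesis
    unfolding B_const_def gauss_tilt_eq set_lebesgue_integral_def
    by simp
qed

lemma B_const_pos: "B_const \<gamma> > 0"
proof -
  have "(LBINT x:{..0::real}. 0) < B_const \<gamma>"
    unfolding B_const_eq_integral
    by (intro set_integral_nonpos_strict_mono[where ?x0.0 = "-1"] gauss_tilt_integrable)
       (auto intro!: continuous_intros simp: set_integrable_def)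
  thus ?thesis
    by (simp add: set_lebesgue_integral_def)
qed

text \<open>Only \<open>\<gamma> < 0\<close> needs an argument: dropping the factor \<open>exp (- x\<^sup>2 / 2)\<close> from the integral
  for \<^const>\<open>B_const\<close> increases it strictly, to \<open>- 1 / \<gamma>\<close>.\<close>

lemma mills_ratio_bound: "\<gamma> * B_const \<gamma> + 1 > 0"
proof (cases "\<gamma> < 0")
  case True
  have "set_integrable lborel {..0} (\<lambda>x. exp (- \<gamma> * x))"
    and val: "(LBINT x:{..0}. exp (- \<gamma> * x)) = 1 / (- \<gamma>)"
    using has_bochner_integral_exp_nonpos[of "- \<gamma>"] True
    by (auto simp: set_integrable_def set_lebesgue_integral_def has_bochner_integral_iff)
  hence "B_const \<gamma> < (LBINT x:{..0}. exp (- \<gamma> * x))"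
    unfolding B_const_eq_integral
    by (intro set_integral_nonpos_strict_mono[where ?x0.0 = "-1"] gauss_tilt_integrable)
       (auto intro!: continuous_intros)
  thus ?thesis
    using True unfolding val by (simp add: field_simps)
next
  case False
  thus ?thesis
    using B_const_pos[of \<gamma>] by (simp add: add_nonneg_pos)
qed

text \<open>The upper bound is strict because \<open>rL\<close> is not identically \<open>1\<close>, the lower one because
  \<open>rL\<close> is continuous at \<open>0\<close> with value \<open>1\<close>, hence positive somewhere to the left of \<open>0\<close>.\<close>

lemma A_const_bounds:
  assumes "admissible_left rL"
  shows "0 < A_const \<gamma> rL" "A_const \<gamma> rL < B_const \<gamma>"
proof -
  let ?w = "\<lambda>x :: real. exp (- x\<^sup>2 / 2 - \<gamma> * x)"
  have range: "\<And>x. x \<le> 0 \<Longrightarrow> 0 \<le> rL x \<and> rL x \<le> 1" and cont: "continuous_on {..0} rL"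
    and one: "rL 0 = 1" and "\<exists>x\<le>0. rL x \<noteq> 1"
    using assms by (auto simp: admissible_left_def)
  then obtain x0 where x0: "x0 < 0" "rL x0 < 1"
    by (metis order_le_less)
  have contw: "continuous_on {..0} (\<lambda>x. rL x * ?w x)"
    by (intro continuous_intros cont) auto
  have int: "set_integrable lborel {..0} (\<lambda>x. rL x * ?w x)"
  proof (rule set_integrable_bound[OF gauss_tilt_integrable[of \<gamma>]])
    show "set_borel_measurable lborel {..0} (\<lambda>x. rL x * ?w x)"
      using borel_measurable_continuous_on_indicator[OF _ contw]
      by (simp add: set_borel_measurable_def)
    show "AE x in lborel. x \<in> {..0} \<longrightarrow> norm (rL x * ?w x) \<le> norm (?w x)"
      using range by (auto simp: abs_mult intro!: mult_left_le_one_le)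
  qed
  show "A_const \<gamma> rL < B_const \<gamma>"
    unfolding A_const_def B_const_eq_integral
    using x0 range
    by (intro set_integral_nonpos_strict_mono[where ?x0.0 = x0] int gauss_tilt_integrable contw)
       (auto intro!: continuous_intros mult_left_le_one_le)
  obtain x1 where x1: "x1 < 0" "0 < rL x1"
  proof -
    obtain e where e: "e > 0" "\<And>x. x \<le> 0 \<Longrightarrow> dist x 0 < e \<Longrightarrow> dist (rL x) (rL 0) < 1"
      using cont unfolding continuous_on_iff
      by (metis atMost_iff order_refl zero_less_one)
    have "dist (rL (- e / 2)) (rL 0) < 1"
      using e(1) by (intro e(2)) (auto simp: dist_real_def)
    thus ?thesis
      using e(1) one by (intro that[of "- e / 2"]) (auto simp: dist_real_def)
  qed
  have "(LBINT x:{..0::real}. 0) < A_const \<gamma> rL"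
    unfolding A_const_def
    by (rule set_integral_nonpos_strict_mono[where ?x0.0 = x1])
       (use int contw x1 range in \<open>auto simp: set_integrable_def\<close>)
  thus "0 < A_const \<gamma> rL"
    by (simp add: set_lebesgue_integral_def)
qed

section \<open>The real branches of the Lambert function\<close>

lemma mult_exp_strict_mono_right:
  fixes v w :: real
  assumes "-1 \<le> v" "v < w"
  shows "v * exp v < w * exp w"
proof (rule DERIV_pos_imp_increasing_open[OF assms(2)])
  fix x assume "v < x" "x < w"
  moreover have "((\<lambda>x. x * exp x) has_real_derivative (1 + x) * exp x) (at x)"
    by (auto intro!: derivative_eq_intros simp: algebra_simps)
  ultimately show "\<exists>y. ((\<lambda>x. x * exp x) has_real_derivative y) (at x) \<and> 0 < y"
    using assms by (intro exI[of _ "(1 + x) * exp x"]) auto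
qed (auto intro!: continuous_intros)

lemma mult_exp_strict_antimono_left:
  fixes v w :: real
  assumes "v < w" "w \<le> -1"
  shows "w * exp w < v * exp v"
proof (rule DERIV_neg_imp_decreasing_open[OF assms(1)])
  fix x assume "v < x" "x < w"
  moreover have "((\<lambda>x. x * exp x) has_real_derivative (1 + x) * exp x) (at x)"
    by (auto intro!: derivative_eq_intros simp: algebra_simps)
  ultimately show "\<exists>y. ((\<lambda>x. x * exp x) has_real_derivative y) (at x) \<and> y < 0"
    using assms by (intro exI[of _ "(1 + x) * exp x"]) (auto simp: mult_neg_pos)
qed (auto intro!: continuous_intros)

lemma mult_exp_ge: "- exp (-1) \<le> w * exp (w :: real)"
  using mult_exp_strict_mono_right[of "-1" w] mult_exp_strict_antimono_left[of w "-1"]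
  by (cases w "-1 :: real" rule: linorder_cases) auto

lemma lambert_W0_mult_exp: "-1 \<le> w \<Longrightarrow> lambert_W0 (w * exp w) = w"
  unfolding lambert_W0_def
  by (rule the_equality) (auto, metis linorder_neqE less_irrefl mult_exp_strict_mono_right)

lemma lambert_Wm1_mult_exp: "w \<le> -1 \<Longrightarrow> lambert_Wm1 (w * exp w) = w"
  unfolding lambert_Wm1_def
  by (rule the_equality) (auto, metis linorder_neqE less_irrefl mult_exp_strict_antimono_left)

lemma lambert_W0_solves:
  assumes "- exp (-1) \<le> z" "z < 0"
  shows "-1 \<le> lambert_W0 z" "lambert_W0 z * exp (lambert_W0 z) = z"
proof -
  have "\<exists>w. -1 \<le> w \<and> w \<le> 0 \<and> w * exp w = z"
    by (rule IVT') (use assms in \<open>auto intro!: continuous_intros\<close>)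
  then obtain w where "-1 \<le> w" "z = w * exp w" by auto
  thus "-1 \<le> lambert_W0 z" "lambert_W0 z * exp (lambert_W0 z) = z"
    by (simp_all add: lambert_W0_mult_exp)
qed

lemma lambert_Wm1_solves:
  assumes "- exp (-1) \<le> z" "z < 0"
  shows "lambert_Wm1 z \<le> -1" "lambert_Wm1 z * exp (lambert_Wm1 z) = z"
proof -
  have "((\<lambda>w :: real. w * exp w) \<longlongrightarrow> 0) at_bot"
    by real_asymp
  hence "eventually (\<lambda>w. z < w * exp w \<and> w \<le> -1) at_bot"
    using assms by (intro eventually_conj order_tendstoD eventually_le_at_bot)
  then obtain v where v: "z < v * exp v" "v \<le> -1"
    by (auto dest!: eventually_happens)
  have "\<exists>w. v \<le> w \<and> w \<le> -1 \<and> w * exp w = z"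
    by (rule IVT2') (use assms v in \<open>auto intro!: continuous_intros\<close>)
  then obtain w where "w \<le> -1" "z = w * exp w" by auto
  thus "lambert_Wm1 z \<le> -1" "lambert_Wm1 z * exp (lambert_Wm1 z) = z"
    by (simp_all add: lambert_Wm1_mult_exp)
qed

section \<open>The threshold equation\<close>

lemma integral_exp_Icc:
  fixes \<gamma> :: real
  assumes "\<gamma> \<noteq> 0" "0 \<le> \<eta>"
  shows "(LBINT x:{0..\<eta>}. exp (- \<gamma> * x)) = (1 - exp (- \<gamma> * \<eta>)) / \<gamma>"
proof -
  have "(\<integral>x. exp (- \<gamma> * x) * indicator {0..\<eta>} x \<partial>lborel)
      = - exp (- \<gamma> * \<eta>) / \<gamma> - (- exp (- \<gamma> * 0) / \<gamma>)"
    using assms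
    by (intro integral_FTC_Icc_real[where F = "\<lambda>x. - exp (- \<gamma> * x) / \<gamma>"])
       (auto intro!: derivative_eq_intros)
  thus ?thesis
    by (simp add: set_lebesgue_integral_def mult.commute diff_divide_distrib)
qed

lemma integral_ramp_exp_Icc:
  fixes \<gamma> d :: real
  assumes "\<gamma> \<noteq> 0" "d \<noteq> 0" "0 \<le> \<eta>"
  shows "(LBINT x:{0..\<eta>}. (1 - x / d) * exp (- \<gamma> * x)) =
    (1 - (1 - \<eta> / d) * exp (- \<gamma> * \<eta>)) / \<gamma> - (1 - exp (- \<gamma> * \<eta>)) / (d * \<gamma>\<^sup>2)"
proof -
  define F where "F x = exp (- \<gamma> * x) / (d * \<gamma>\<^sup>2) - (1 - x / d) * exp (- \<gamma> * x) / \<gamma>" for x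
  have "(\<integral>x. (1 - x / d) * exp (- \<gamma> * x) * indicator {0..\<eta>} x \<partial>lborel) = F \<eta> - F 0"
  proof (rule integral_FTC_Icc_real[where F = F])
    fix x
    show "(F has_real_derivative (1 - x / d) * exp (- \<gamma> * x)) (at x)"
      unfolding F_def using assms
      by (auto intro!: derivative_eq_intros simp: field_simps power2_eq_square)
  qed (use assms in auto)
  also have "F \<eta> - F 0 =
      (1 - (1 - \<eta> / d) * exp (- \<gamma> * \<eta>)) / \<gamma> - (1 - exp (- \<gamma> * \<eta>)) / (d * \<gamma>\<^sup>2)"
    by (simp add: F_def diff_divide_distrib)
  finally show ?thesis
    by (simp add: set_lebesgue_integral_def mult.commute)
qed

text \<open>By \<open>threshold_gap_eq\<close> below this is, for \<open>\<eta> \<ge> 0\<close>, the difference between \<open>1 - \<eta> / d\<close> and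
  the threshold quotient of the ramp, multiplied by the denominator of the quotient. The closed form is the definition since it makes
  sense for negative arguments as well, where the spurious Lambert branch has its zero.\<close>

definition threshold_gap :: "real \<Rightarrow> real \<Rightarrow> real \<Rightarrow> real \<Rightarrow> real \<Rightarrow> real"
  where "threshold_gap d \<gamma> A B \<eta> =
    B - A - ((B + 1 / \<gamma>) * \<eta> - (1 - exp (- \<gamma> * \<eta>)) / \<gamma>\<^sup>2) / d"

lemma threshold_gap_eq:
  assumes "\<gamma> \<noteq> 0" "d \<noteq> 0" "0 \<le> \<eta>"
  shows "threshold_gap d \<gamma> A B \<eta> =
    (1 - \<eta> / d) * (B + (LBINT x:{0..\<eta>}. exp (- \<gamma> * x)))
      - (A + (LBINT x:{0..\<eta>}. (1 - x / d) * exp (- \<gamma> * x)))"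
  unfolding integral_exp_Icc[OF assms(1,3)] integral_ramp_exp_Icc[OF assms] threshold_gap_def
  using assms by (simp add: field_simps power2_eq_square)

lemma one_minus_exp_div_nonneg:
  assumes "0 \<le> \<eta>"
  shows "0 \<le> (1 - exp (- \<gamma> * \<eta>)) / (\<gamma> :: real)"
proof (cases \<gamma> "0 :: real" rule: linorder_cases)
  case less
  thus ?thesis using assms by (auto intro!: divide_nonpos_neg simp: mult_nonpos_nonneg)
qed (use assms in auto)

text \<open>In the derivative of the product \<open>(1 - \<eta> / d) * (B + \<integral>)\<close> the contribution of the second
  factor cancels against the derivative of the subtracted integral. What remains is
  \<open>- 1 / d\<close> times the denominator of \<^const>\<open>R_T\<close>.\<close>

lemma threshold_gap_strict_antimono:
  assumes "\<gamma> \<noteq> 0" "d > 0" "B > 0" "0 \<le> s" "s < t"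
  shows "threshold_gap d \<gamma> A B t < threshold_gap d \<gamma> A B s"
proof (rule DERIV_neg_imp_decreasing[OF \<open>s < t\<close>])
  fix x assume "s \<le> x"
  have "0 < (B + (1 - exp (- \<gamma> * x)) / \<gamma>) / d"
    using one_minus_exp_div_nonneg[of x \<gamma>] \<open>s \<le> x\<close> assms by (auto intro!: divide_pos_pos)
  moreover have "(threshold_gap d \<gamma> A B has_real_derivative
      - ((B + (1 - exp (- \<gamma> * x)) / \<gamma>) / d)) (at x)"
    unfolding threshold_gap_def[abs_def] using assms
    by (auto intro!: derivative_eq_intros simp: field_simps power2_eq_square)
  ultimately show "\<exists>y. (threshold_gap d \<gamma> A B has_real_derivative y) (at x) \<and> y < 0"
    by (intro exI[of _ "- ((B + (1 - exp (- \<gamma> * x)) / \<gamma>) / d)"]) auto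
qed

text \<open>At \<open>d\<close> the ramp vanishes, so that only the negated numerator of \<^const>\<open>R_T\<close> is left.\<close>

lemma threshold_gap_at_ramp_end:
  assumes "\<gamma> \<noteq> 0" "d > 0" "A > 0"
  shows "threshold_gap d \<gamma> A B d < 0"
proof -
  have "0 \<le> (LBINT x:{0..d}. (1 - x / d) * exp (- \<gamma> * x))"
    unfolding set_lebesgue_integral_def using assms
    by (intro integral_nonneg_AE) (auto simp: indicator_def)
  thus ?thesis
    using assms by (subst threshold_gap_eq) auto
qed

lemma threshold_gap_root:
  assumes "\<gamma> \<noteq> 0" "d > 0" "0 < A" "A < B"
  obtains \<eta> where "0 < \<eta>" "threshold_gap d \<gamma> A B \<eta> = 0"
proof -
  have pos: "threshold_gap d \<gamma> A B 0 > 0"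
    using assms by (simp add: threshold_gap_def)
  have "\<exists>\<eta>. 0 \<le> \<eta> \<and> \<eta> \<le> d \<and> threshold_gap d \<gamma> A B \<eta> = 0"
    using pos threshold_gap_at_ramp_end[of \<gamma> d A B] assms
    by (intro IVT2') (auto simp: threshold_gap_def[abs_def] intro!: continuous_intros)
  thus ?thesis
    using pos that by (metis order_le_less less_irrefl)
qed

text \<open>The equivalence extends beyond \<open>d\<close>, although \<^const>\<open>threshold_gap\<close> no longer represents
  the equation there: both sides are false, the left one because \<open>r\<close> vanishes and
  \<^const>\<open>R_T\<close> is positive, the right one because the gap is negative at \<open>d\<close> and decreases.\<close>

lemma threshold_eq_iff_gap:
  fixes rL rR :: "real \<Rightarrow> real"
  assumes "d > 0" "\<gamma> \<noteq> 0" "admissible_left rL" "0 \<le> \<eta>"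
    and rR: "\<And>x. x \<ge> 0 \<Longrightarrow> rR x = (1 - x / d) * indicator {0..d} x"
  shows "glue rL rR \<eta> = R_T \<gamma> rL rR \<eta> \<longleftrightarrow>
    threshold_gap d \<gamma> (A_const \<gamma> rL) (B_const \<gamma>) \<eta> = 0"
proof -
  let ?A = "A_const \<gamma> rL" and ?B = "B_const \<gamma>"
  let ?D = "?B + (LBINT x:{0..\<eta>}. exp (- \<gamma> * x))"
  have "rL 0 = 1"
    using assms by (simp add: admissible_left_def)
  hence glue: "glue rL rR x = (1 - x / d) * indicator {0..d} x" if "0 \<le> x" for x
    using that rR[of x] \<open>d > 0\<close> by (auto simp: glue_def)
  note A = A_const_bounds[OF assms(3), of \<gamma>]
  have D: "?D > 0"
    unfolding integral_exp_Icc[OF assms(2,4)]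
    using one_minus_exp_div_nonneg[OF assms(4), of \<gamma>] B_const_pos[of \<gamma>] by linarith
  show ?thesis
  proof (cases "\<eta> \<le> d")
    case True
    have "(LBINT x:{0..\<eta>}. glue rL rR x * exp (- \<gamma> * x))
        = (LBINT x:{0..\<eta>}. (1 - x / d) * exp (- \<gamma> * x))"
      using True by (intro set_lebesgue_integral_cong) (auto simp: glue)
    hence quotient: "R_T \<gamma> rL rR \<eta> = (?A + (LBINT x:{0..\<eta>}. (1 - x / d) * exp (- \<gamma> * x))) / ?D"
      by (simp only: R_T_def)
    have ramp: "glue rL rR \<eta> = 1 - \<eta> / d"
      using True assms by (simp add: glue)
    have gap: "threshold_gap d \<gamma> ?A ?B \<eta> = (1 - \<eta> / d) * ?D
        - (?A + (LBINT x:{0..\<eta>}. (1 - x / d) * exp (- \<gamma> * x)))"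
      using \<open>d > 0\<close> by (intro threshold_gap_eq assms) simp
    have "u = v / ?D \<longleftrightarrow> u * ?D - v = 0" for u v
      using D by (simp only: eq_divide_eq) (auto simp del: mult_minus_left)
    thus ?thesis unfolding quotient ramp gap .
  next
    case False
    have "0 \<le> (LBINT x:{0..\<eta>}. glue rL rR x * exp (- \<gamma> * x))"
      unfolding set_lebesgue_integral_def using \<open>d > 0\<close>
      by (intro integral_nonneg_AE AE_I2) (auto simp: indicator_def glue)
    hence "R_T \<gamma> rL rR \<eta> > 0"
      unfolding R_T_def using A D by (intro divide_pos_pos) auto
    moreover have "glue rL rR \<eta> = 0"
      using False assms by (simp add: glue)
    moreover have "threshold_gap d \<gamma> ?A ?B \<eta> < 0"
      using threshold_gap_strict_antimono[of \<gamma> d ?B d \<eta> ?A]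
        threshold_gap_at_ramp_end[of \<gamma> d ?A ?B] False assms A B_const_pos[of \<gamma>] by linarith
    ultimately show ?thesis by simp
  qed
qed

text \<open>A zero satisfies \<open>c * (\<eta> - r0) = - exp (- \<gamma> * \<eta>) / \<gamma>\<^sup>2\<close>. Writing
  \<open>exp (- \<gamma> * \<eta>) = exp (- \<gamma> * r0) * exp (- w)\<close> collects the unknown in the form \<open>w * exp w\<close>.\<close>

lemma threshold_gap_zero_iff_lambert:
  assumes "\<gamma> \<noteq> 0" "d > 0" "c \<noteq> 0" and c: "c = B + 1 / \<gamma>"
    and r0: "r0 = (d * (B - A) + 1 / \<gamma>\<^sup>2) / c"
    and w: "w = \<gamma> * (\<eta> - r0)"
  shows "threshold_gap d \<gamma> A B \<eta> = 0 \<longleftrightarrow> w * exp w = - exp (- \<gamma> * r0) / (\<gamma> * c)"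
proof -
  have "threshold_gap d \<gamma> A B \<eta> = 0 \<longleftrightarrow>
      d * (B - A) = c * \<eta> - (1 - exp (- \<gamma> * \<eta>)) / \<gamma>\<^sup>2"
    using \<open>d > 0\<close> by (simp add: threshold_gap_def c[symmetric] eq_divide_eq mult.commute)
  also have "\<dots> \<longleftrightarrow> c * (\<eta> - r0) = - exp (- \<gamma> * \<eta>) / \<gamma>\<^sup>2"
  proof -
    have "c * r0 = d * (B - A) + 1 / \<gamma>\<^sup>2"
      using \<open>c \<noteq> 0\<close> by (simp add: r0)
    thus ?thesis
      by (simp add: right_diff_distrib diff_divide_distrib) linarith
  qed
  also have "\<dots> \<longleftrightarrow> w = - exp (- \<gamma> * \<eta>) / (\<gamma> * c)"
    using assms(1,3) by (simp add: w field_simps power2_eq_square)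
  also have "exp (- \<gamma> * \<eta>) = exp (- \<gamma> * r0) / exp w"
    by (simp add: w algebra_simps flip: exp_diff)
  also have "w = - (exp (- \<gamma> * r0) / exp w) / (\<gamma> * c) \<longleftrightarrow> w * exp w = - exp (- \<gamma> * r0) / (\<gamma> * c)"
  proof -
    have eq: "- (u / exp w) / v = - u / v / exp w" for u v :: real
      by simp
    show ?thesis
      unfolding eq by (rule nonzero_eq_divide_eq[OF exp_not_eq_zero])
  qed
  finally show ?thesis .
qed

theorem proposition8:
  fixes d \<gamma> A B a\<^sub>0 r\<^sub>0 z :: real and rL rR :: "real \<Rightarrow> real"
  assumes "d > 0" and "\<gamma> \<noteq> 0"
    and "admissible_left rL"
    and "\<And>x. x \<ge> 0 \<Longrightarrow> rR x = (1 - x / d) * indicator {0..d} x"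
    and "A = A_const \<gamma> rL" and "B = B_const \<gamma>"
    and "a\<^sub>0 = - \<gamma>\<^sup>2 * (B + 1 / \<gamma>)"
    and "r\<^sub>0 = (d * (B - A) + 1 / \<gamma>\<^sup>2) / (B + 1 / \<gamma>)"
    and "z = \<gamma> * exp (- \<gamma> * r\<^sub>0) / a\<^sub>0"
  shows "B + 1 / \<gamma> \<noteq> 0 \<and> - exp (-1) \<le> z \<and> z < 0 \<and>
    (\<exists>!W. W \<in> {lambert_W0, lambert_Wm1} \<and> r\<^sub>0 + 1 / \<gamma> * W z > 0) \<and>
    (\<forall>W \<in> {lambert_W0, lambert_Wm1}. r\<^sub>0 + 1 / \<gamma> * W z > 0 \<longrightarrow>
      {\<eta>. \<eta> \<ge> 0 \<and> glue rL rR \<eta> = R_T \<gamma> rL rR \<eta>} = {r\<^sub>0 + 1 / \<gamma> * W z})"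
proof -
  define c where "c = B + 1 / \<gamma>"
  have AB: "0 < A" "A < B" and "0 < B"
    using A_const_bounds[OF assms(3), of \<gamma>] B_const_pos[of \<gamma>] assms(5,6) by auto
  have gc: "\<gamma> * c > 0"
    using mills_ratio_bound[of \<gamma>] assms(2,6) by (simp add: c_def distrib_left)
  hence "c \<noteq> 0" by auto
  have z: "z = - exp (- \<gamma> * r\<^sub>0) / (\<gamma> * c)"
    using assms(2) \<open>c \<noteq> 0\<close> by (simp add: assms(7,9) power2_eq_square flip: c_def)
  have "z < 0"
    using gc by (simp add: z divide_neg_pos)
  have gap_iff: "threshold_gap d \<gamma> A B \<eta> = 0 \<longleftrightarrow>
      \<gamma> * (\<eta> - r\<^sub>0) * exp (\<gamma> * (\<eta> - r\<^sub>0)) = z" for \<eta>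
    unfolding z using assms(8) \<open>c \<noteq> 0\<close> assms(1,2)
    by (intro threshold_gap_zero_iff_lambert c_def) (auto simp: c_def)
  obtain \<eta> where \<eta>: "0 < \<eta>" "threshold_gap d \<gamma> A B \<eta> = 0"
    using threshold_gap_root[OF assms(2,1) AB] .
  have unique: "t = \<eta>" if "0 \<le> t" "threshold_gap d \<gamma> A B t = 0" for t
    using threshold_gap_strict_antimono[OF assms(2,1) \<open>0 < B\<close>, of t \<eta> A]
      threshold_gap_strict_antimono[OF assms(2,1) \<open>0 < B\<close>, of \<eta> t A] \<eta> that
    by (cases t \<eta> rule: linorder_cases) auto
  have solutions: "{t. t \<ge> 0 \<and> glue rL rR t = R_T \<gamma> rL rR t} = {\<eta>}"
    using threshold_eq_iff_gap[OF assms(1,2,3) _ assms(4), of _] \<eta> unique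
    by (auto simp flip: assms(5,6))
  define w where "w = \<gamma> * (\<eta> - r\<^sub>0)"
  have w: "w * exp w = z"
    using gap_iff[of \<eta>] \<eta> by (simp add: w_def)
  have z_ge: "- exp (-1) \<le> z"
    using mult_exp_ge[of w] w by simp
  \<comment> \<open>At \<open>w = -1\<close> the derivative of the gap at \<open>\<eta>\<close> would vanish.\<close>
  have "w \<noteq> -1"
  proof
    assume "w = -1"
    hence "exp (- \<gamma> * \<eta>) = \<gamma> * c"
    proof -
      have "exp (- \<gamma> * r\<^sub>0) = exp (- \<gamma> * \<eta>) * exp w"
        by (simp add: w_def algebra_simps flip: exp_add)
      thus ?thesis
        using w z gc \<open>w = -1\<close> by (auto simp: eq_divide_eq split: if_splits)
    qed
    hence "exp (- \<gamma> * \<eta>) = \<gamma> * B + 1"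
      using assms(2) by (simp add: c_def distrib_left)
    hence "B + (1 - exp (- \<gamma> * \<eta>)) / \<gamma> = 0"
      using assms(2) by simp
    thus False
      using one_minus_exp_div_nonneg[of \<eta> \<gamma>] \<eta>(1) \<open>0 < B\<close> by linarith
  qed
  note W0 = lambert_W0_solves[OF z_ge \<open>z < 0\<close>] and Wm1 = lambert_Wm1_solves[OF z_ge \<open>z < 0\<close>]
  have pos_iff: "r\<^sub>0 + 1 / \<gamma> * v > 0 \<longleftrightarrow> v = w" if "v * exp v = z" for v
  proof
    assume "r\<^sub>0 + 1 / \<gamma> * v > 0"
    moreover have "\<gamma> * (r\<^sub>0 + 1 / \<gamma> * v - r\<^sub>0) = v"
      using assms(2) by simp
    ultimately have "r\<^sub>0 + 1 / \<gamma> * v = \<eta>"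
      using that by (intro unique) (auto simp: gap_iff)
    thus "v = w"
      using assms(2) by (auto simp: w_def)
  qed (use \<eta> assms(2) in \<open>simp add: w_def\<close>)
  \<comment> \<open>The branches take values on different sides of \<open>-1\<close>, so exactly one of them returns \<open>w\<close>.\<close>
  have "lambert_W0 z = w \<longleftrightarrow> lambert_Wm1 z \<noteq> w"
  proof (cases "w < -1")
    case True
    thus ?thesis
      using W0 lambert_Wm1_mult_exp[of w] w by auto
  next
    case False
    thus ?thesis
      using Wm1 lambert_W0_mult_exp[of w] w \<open>w \<noteq> -1\<close> by auto
  qed
  hence ex1: "\<exists>!W. W \<in> {lambert_W0, lambert_Wm1} \<and> W z = w"
    by (cases "lambert_W0 z = w")
       (blast intro: ex1I[of _ lambert_W0], blast intro: ex1I[of _ lambert_Wm1])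
  have branch_pos: "W \<in> {lambert_W0, lambert_Wm1} \<and> r\<^sub>0 + 1 / \<gamma> * W z > 0 \<longleftrightarrow>
      W \<in> {lambert_W0, lambert_Wm1} \<and> W z = w" for W
    using pos_iff[OF W0(2)] pos_iff[OF Wm1(2)] by blast
  have "{t. t \<ge> 0 \<and> glue rL rR t = R_T \<gamma> rL rR t} = {r\<^sub>0 + 1 / \<gamma> * W z}"
    if "W \<in> {lambert_W0, lambert_Wm1}" "r\<^sub>0 + 1 / \<gamma> * W z > 0" for W
  proof -
    have "W z = w"
      using branch_pos[of W] that by blast
    thus ?thesis
      unfolding solutions using assms(2) by (simp add: w_def)
  qed
  moreover have "\<exists>!W. W \<in> {lambert_W0, lambert_Wm1} \<and> r\<^sub>0 + 1 / \<gamma> * W z > 0"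
    unfolding branch_pos by (fact ex1)
  ultimately show ?thesis
    using \<open>c \<noteq> 0\<close> z_ge \<open>z < 0\<close> unfolding c_def by blast
qed

end
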